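(* Let $r\in\mathbb N$ and let $\mathbb N=C_1\cup\dots\cup C_r$ be a finite colouring. Then there are $m\le r$ and sequences $(x_i)_{i\in\mathbb N}$ and $(y_i)_{i\in\mathbb N}$ of natural numbers such that $$\operatorname{FS}(x_i\mid i\in\mathbb N)\ \cup\ \left\{\frac{\sum_{i\in G}x_i}{\sum_{i\in F}x_i}\ \middle|\ F,G\in\mathcal P_{\mathrm{fin}}(\mathbb N)\setminus\{\emptyset\},\ F<G\right\}\subseteq C_m$$ and $$\left\{\sum_{\ell\in F}\ \prod_{i=k}^{\ell}y_i\ \middle|\ F\in\mathcal P_{\mathrm{fin}}(\mathbb N)\setminus\{\emptyset\},\ k\in\mathbb N,\ k\le\min F\right\}\subseteq C_m.$$ Moreover, if $u\in\beta\mathbb N$ is any additively idempotent ultrafilter, then one may take as $C_m$ the colour belonging to the ultrafilter $D(u\otimes u)$.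
   Context: $\mathbb N$ denotes the set of positive integers ($0\notin\mathbb N$). A finite colouring of $\mathbb N$ is a partition of $\mathbb N$ into finitely many pieces, called colours. $\mathcal P_{\mathrm{fin}}(\mathbb N)$ is the set of finite subsets of $\mathbb N$; for nonempty finite $F,G\subseteq\mathbb N$, $F<G$ means $\max F<\min G$. $\operatorname{FS}(x_i\mid i\in\mathbb N)=\{x_{i_1}+\dots+x_{i_k}\mid k\in\mathbb N,\ i_1<\dots<i_k\}$. The function $D:\mathbb N^2\to\mathbb N$ sends $(x,y)$ to $y/x$ if $x\mid y$ and to $1$ otherwise. $\beta\mathbb N$ is the set of ultrafilters on $\mathbb N$. For $u\in\beta\mathbb N$, $u\otimes u$ is the ultrafilter on $\mathbb N^2$ given by $A\in u\otimes u\iff\{a\mid\{b\mid(a,b)\in A\}\in u\}\in u$. For an ultrafilter $w$ on $\mathbb N^k$ and $f:\mathbb N^k\to\mathbb N$, $f(w)=\{A\subseteq\mathbb N\mid f^{-1}(A)\in w\}$ is the pushforward. An ultrafilter $u\in\beta\mathbb N$ is additively idempotent if its pushforward identity $u=S(u\otimes u)$ holds, where $S(a,b)=a+b$. *)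

theory Defs
  imports Complex_Main "HOL-Library.Disjoint_Sets"
begin

text \<open>
  The positive integers are the subset \<open>\<nat>\<^sub>+\<close> of the type \<open>nat\<close>; sequences are functions on \<open>nat\<close>
  of which only the values at indices in \<open>\<nat>\<^sub>+\<close> are used.
\<close>

definition Npos :: "nat set" ("\<nat>\<^sub>+") where
  "\<nat>\<^sub>+ = {n. 1 \<le> n}"

definition finite_colouring :: "nat \<Rightarrow> (nat \<Rightarrow> nat set) \<Rightarrow> bool" where
  "finite_colouring r C \<longleftrightarrow>
     (\<Union>m\<in>{1..r}. C m) = \<nat>\<^sub>+ \<and> disjoint_family_on C {1..r}"

definition Pfin :: "nat set set" where
  "Pfin = {F. F \<subseteq> \<nat>\<^sub>+ \<and> finite F \<and> F \<noteq> {}}"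

definition FS :: "(nat \<Rightarrow> nat) \<Rightarrow> nat set" where
  "FS x = {\<Sum>i\<in>F. x i | F. F \<in> Pfin}"

text \<open>The quotients are taken in \<open>rat\<close>, so that membership in a colour includes integrality.\<close>

definition FS_quotients :: "(nat \<Rightarrow> nat) \<Rightarrow> rat set" where
  "FS_quotients x =
     {of_nat (\<Sum>i\<in>G. x i) / of_nat (\<Sum>i\<in>F. x i) | F G.
        F \<in> Pfin \<and> G \<in> Pfin \<and> Max F < Min G}"

definition sums_of_products :: "(nat \<Rightarrow> nat) \<Rightarrow> nat set" where
  "sums_of_products y =
     {\<Sum>l\<in>F. \<Prod>i=k..l. y i | F k. F \<in> Pfin \<and> k \<in> \<nat>\<^sub>+ \<and> k \<le> Min F}"

definition D :: "nat \<times> nat \<Rightarrow> nat" where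
  "D = (\<lambda>(x, y). if x dvd y then y div x else 1)"

text \<open>
  An ultrafilter is represented by a library filter: a set \<open>A\<close> belongs to \<open>u\<close> iff
  \<open>eventually (\<lambda>a. a \<in> A) u\<close>, and the pushforward along \<open>f\<close> is \<open>filtermap f\<close>. The filter
  \<open>bot\<close> is the improper one, containing the empty set. Ultrafilters on \<open>\<nat>\<^sub>+\<close> are
  ultrafilters on \<open>nat\<close> that contain \<open>\<nat>\<^sub>+\<close>.
\<close>

definition ultrafilter :: "'a filter \<Rightarrow> bool" where
  "ultrafilter u \<longleftrightarrow>
     u \<noteq> bot \<and> (\<forall>P. eventually P u \<or> eventually (\<lambda>a. \<not> P a) u)"

definition beta_Npos :: "nat filter set" where
  "beta_Npos = {u. ultrafilter u \<and> eventually (\<lambda>n. n \<in> \<nat>\<^sub>+) u}"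

definition tensor :: "'a filter \<Rightarrow> 'b filter \<Rightarrow> ('a \<times> 'b) filter" (infixr "\<otimes>\<^sub>u" 70) where
  "u \<otimes>\<^sub>u v =
     Abs_filter (\<lambda>P. eventually (\<lambda>a. eventually (\<lambda>b. P (a, b)) v) u)"

lemma eventually_tensor:
  "eventually P (u \<otimes>\<^sub>u v) \<longleftrightarrow> eventually (\<lambda>a. eventually (\<lambda>b. P (a, b)) v) u"
proof -
  have "is_filter (\<lambda>P. eventually (\<lambda>a. eventually (\<lambda>b. P (a, b)) v) u)"
  proof
    fix P Q :: "'a \<times> 'b \<Rightarrow> bool"
    assume "eventually (\<lambda>a. eventually (\<lambda>b. P (a, b)) v) u"
      and "eventually (\<lambda>a. eventually (\<lambda>b. Q (a, b)) v) u"
    then show "eventually (\<lambda>a. eventually (\<lambda>b. P (a, b) \<and> Q (a, b)) v) u"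
      by eventually_elim (rule eventually_conj)
  next
    fix P Q :: "'a \<times> 'b \<Rightarrow> bool"
    assume "\<forall>p. P p \<longrightarrow> Q p"
      and "eventually (\<lambda>a. eventually (\<lambda>b. P (a, b)) v) u"
    then show "eventually (\<lambda>a. eventually (\<lambda>b. Q (a, b)) v) u"
      by (auto elim!: eventually_mono)
  qed simp
  then show ?thesis
    unfolding tensor_def by (rule eventually_Abs_filter)
qed

definition additively_idempotent :: "nat filter \<Rightarrow> bool" where
  "additively_idempotent u \<longleftrightarrow> u = filtermap (\<lambda>(a, b). a + b) (u \<otimes>\<^sub>u u)"

end

theory Submission
  imports Defs
begin

text \<open>
  Let \<open>A\<close> be the colour in \<open>D(u \<otimes> u)\<close>. An idempotent \<open>u\<close> contains all multiples of every
  positive integer, so for \<open>u\<close>-many \<open>a\<close> and then \<open>u\<close>-many \<open>b\<close>, \<open>a\<close> divides \<open>b\<close> and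
  \<open>b / a \<in> A\<close>. The Galvin construction yields a sequence \<open>z\<close> all of whose quotients
  \<open>z\<^sub>G / z\<^sub>F\<close> with \<open>F < G\<close> (writing \<open>z\<^sub>F\<close> for the sum over \<open>F\<close>) lie in \<open>A\<close>. Both
  conclusions are special cases: take \<open>x\<^sub>i = z\<^sub>i / z\<^sub>0\<close> and \<open>y\<^sub>i = z\<^sub>i / z\<^bsub>i-1\<^esub>\<close>, so that
  sums of the \<open>x\<^sub>i\<close> are quotients with \<open>F = {0}\<close>, and products of consecutive \<open>y\<^sub>i\<close> telescope.
  An idempotent ultrafilter is found as a minimal proper filter \<open>F\<close> with \<open>F + F \<le> F\<close>.
\<close>

section \<open>Ultrafilters\<close>

lemma ultrafilter_not_eventually:
  assumes "ultrafilter u"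
  shows "eventually (\<lambda>a. \<not> P a) u \<longleftrightarrow> \<not> eventually P u"
proof
  assume "eventually (\<lambda>a. \<not> P a) u"
  then show "\<not> eventually P u"
    using assms eventually_elim2[of "\<lambda>a. \<not> P a" u P "\<lambda>_. False"]
    by (auto simp: ultrafilter_def eventually_False)
qed (use assms in \<open>auto simp: ultrafilter_def\<close>)

lemma ultrafilter_finite_union:
  assumes "ultrafilter u" and "finite J" and "eventually (\<lambda>a. \<exists>j\<in>J. P j a) u"
  shows "\<exists>j\<in>J. eventually (P j) u"
proof (rule ccontr)
  assume "\<not> ?thesis"
  then have "\<forall>j\<in>J. eventually (\<lambda>a. \<not> P j a) u"
    using assms(1) by (simp add: ultrafilter_not_eventually)
  then have "eventually (\<lambda>a. \<not> (\<exists>j\<in>J. P j a)) u"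
    using assms(2) by (simp add: eventually_ball_finite)
  then show False
    using assms(3) ultrafilter_not_eventually[OF assms(1)] by blast
qed

lemma ultrafilter_filtermap: "ultrafilter u \<Longrightarrow> ultrafilter (filtermap f u)"
  by (simp add: ultrafilter_def eventually_filtermap filtermap_bot_iff)

lemma ultrafilter_tensor:
  assumes "ultrafilter u" and "ultrafilter v"
  shows "ultrafilter (u \<otimes>\<^sub>u v)"
proof -
  have "\<not> eventually (\<lambda>_. False) (u \<otimes>\<^sub>u v)"
    using assms by (simp add: eventually_tensor ultrafilter_def)
  then show ?thesis
    using assms
    by (auto simp: ultrafilter_def eventually_tensor trivial_limit_def
        ultrafilter_not_eventually[OF assms(1)] ultrafilter_not_eventually[OF assms(2)])
qed

text \<open>Zorn's lemma for the reversed order, with infima as bounds of chains. It supplies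
  minimal proper filters and minimal proper filters with
  \<open>filter_plus F F \<le> F\<close>.\<close>

lemma minimal_filter_exists:
  fixes F\<^sub>0 :: "'a filter"
  assumes "P F\<^sub>0"
    and chain: "\<And>S. S \<noteq> {} \<Longrightarrow> (\<And>F. F \<in> S \<Longrightarrow> P F) \<Longrightarrow>
      (\<And>F G. F \<in> S \<Longrightarrow> G \<in> S \<Longrightarrow> F \<le> G \<or> G \<le> F) \<Longrightarrow> P (Inf S)"
  obtains M where "P M" and "M \<le> F\<^sub>0" and "\<And>F. P F \<Longrightarrow> F \<le> M \<Longrightarrow> F = M"
proof -
  let ?A = "{F. P F \<and> F \<le> F\<^sub>0}"
  have "\<exists>M\<in>?A. \<forall>F\<in>?A. F \<le> M \<longrightarrow> F = M"
  proof (rule predicate_Zorn)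
    show "partial_order_on ?A (relation_of (\<lambda>F G. G \<le> F) ?A)"
      by (rule partial_order_on_relation_ofI) auto
  next
    fix S
    assume S: "S \<in> Chains (relation_of (\<lambda>F G. G \<le> F) ?A)"
    show "\<exists>G\<in>?A. \<forall>F\<in>S. G \<le> F"
    proof (cases "S = {}")
      case True
      then show ?thesis using assms(1) by auto
    next
      case False
      have sub: "S \<subseteq> ?A" and lin: "\<And>F G. F \<in> S \<Longrightarrow> G \<in> S \<Longrightarrow> F \<le> G \<or> G \<le> F"
        using S unfolding Chains_def relation_of_def by auto
      have "P (Inf S)"
        using False sub lin by (intro chain) auto
      moreover have "Inf S \<le> F\<^sub>0"
        using False sub by (auto intro: Inf_lower2)
      ultimately show ?thesis
        by (auto intro: Inf_lower)
    qed
  qed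
  then show thesis
    using that by (metis (mono_tags, lifting) mem_Collect_eq order_trans)
qed

text \<open>A chain is its own filter base, so no finite intersections have to be formed. In
  particular the infimum of a nonempty chain of proper filters is proper.\<close>

lemma eventually_Inf_chain:
  assumes "S \<noteq> {}" and "\<And>F G. F \<in> S \<Longrightarrow> G \<in> S \<Longrightarrow> F \<le> G \<or> G \<le> F"
  shows "eventually P (Inf S) \<longleftrightarrow> (\<exists>F\<in>S. eventually P F)"
proof (rule eventually_Inf_base[OF assms(1)])
  fix F G
  assume "F \<in> S" "G \<in> S"
  then show "\<exists>H\<in>S. H \<le> inf F G"
    using assms(2)[of F G] by (metis le_inf_iff order_refl)
qed

text \<open>A minimal proper filter decides every \<open>P\<close>: unless it contains the
  complement, adjoining \<open>P\<close> keeps it proper, so by minimality \<open>P\<close> was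
  there already.\<close>

lemma ultrafilter_exists:
  fixes F :: "'a filter"
  assumes "F \<noteq> bot"
  obtains u where "ultrafilter u" and "u \<le> F"
proof -
  obtain u where u: "u \<noteq> bot" "u \<le> F" and min: "\<And>G. G \<noteq> bot \<Longrightarrow> G \<le> u \<Longrightarrow> G = u"
  proof (rule minimal_filter_exists[of "\<lambda>G. G \<noteq> bot" F])
    fix S :: "'a filter set"
    assume "S \<noteq> {}" "\<And>G. G \<in> S \<Longrightarrow> G \<noteq> bot"
      and "\<And>F G. F \<in> S \<Longrightarrow> G \<in> S \<Longrightarrow> F \<le> G \<or> G \<le> F"
    then show "Inf S \<noteq> bot"
      by (simp add: trivial_limit_def eventually_Inf_chain)
  qed (use assms in auto)
  have "eventually P u" if "\<not> eventually (\<lambda>a. \<not> P a) u" for P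
  proof -
    have "inf u (principal {a. P a}) \<noteq> bot"
      using that by (simp add: trivial_limit_def eventually_inf_principal)
    then have "inf u (principal {a. P a}) = u"
      by (rule min) simp
    then show ?thesis
      using eventually_inf_principal[of P u "{a. P a}"] by simp
  qed
  then have "ultrafilter u"
    using u(1) by (auto simp: ultrafilter_def)
  then show thesis using u(2) that by blast
qed

section \<open>Sums of filters and idempotents\<close>

definition filter_plus :: "'a::plus filter \<Rightarrow> 'a filter \<Rightarrow> 'a filter" where
  "filter_plus u v = filtermap (\<lambda>(a, b). a + b) (u \<otimes>\<^sub>u v)"

lemma eventually_filter_plus:
  "eventually P (filter_plus u v) \<longleftrightarrow> eventually (\<lambda>a. eventually (\<lambda>b. P (a + b)) v) u"
  by (simp add: filter_plus_def eventually_filtermap eventually_tensor)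

lemma filter_plus_mono: "F \<le> F' \<Longrightarrow> G \<le> G' \<Longrightarrow> filter_plus F G \<le> filter_plus F' G'"
  unfolding le_filter_def eventually_filter_plus by (metis (mono_tags, lifting) eventually_mono)

lemma filter_plus_assoc:
  fixes F G H :: "'a::semigroup_add filter"
  shows "filter_plus (filter_plus F G) H = filter_plus F (filter_plus G H)"
  by (simp add: filter_eq_iff eventually_filter_plus add.assoc)

lemma filter_plus_neq_bot: "F \<noteq> bot \<Longrightarrow> G \<noteq> bot \<Longrightarrow> filter_plus F G \<noteq> bot"
  by (simp add: trivial_limit_def eventually_filter_plus)

text \<open>The Ellis-Numakura argument with filters in place of closed subsemigroups. For a minimal
  \<open>F\<close> and an ultrafilter \<open>u\<close> below it, minimality gives first
  \<open>filter_plus F u = F\<close>, then \<open>filter_plus F u \<le> u\<close>; hence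
  \<open>F = u\<close>.\<close>

lemma idempotent_ultrafilter_exists:
  fixes F\<^sub>0 :: "'a::semigroup_add filter"
  assumes "F\<^sub>0 \<noteq> bot" and "filter_plus F\<^sub>0 F\<^sub>0 \<le> F\<^sub>0"
  obtains u where "ultrafilter u" and "u \<le> F\<^sub>0" and "filter_plus u u = u"
proof -
  let ?P = "\<lambda>F :: 'a filter. F \<noteq> bot \<and> filter_plus F F \<le> F"
  obtain F where F: "F \<noteq> bot" "filter_plus F F \<le> F" "F \<le> F\<^sub>0"
    and min: "\<And>G. G \<noteq> bot \<Longrightarrow> filter_plus G G \<le> G \<Longrightarrow> G \<le> F \<Longrightarrow> G = F"
  proof (rule minimal_filter_exists[of ?P F\<^sub>0])
    fix S :: "'a filter set"
    assume S: "S \<noteq> {}" "\<And>F. F \<in> S \<Longrightarrow> ?P F"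
      and lin: "\<And>F G. F \<in> S \<Longrightarrow> G \<in> S \<Longrightarrow> F \<le> G \<or> G \<le> F"
    have "filter_plus (Inf S) (Inf S) \<le> F" if "F \<in> S" for F
      using S(2)[OF that] filter_plus_mono[OF Inf_lower Inf_lower, OF that that]
      by (meson order_trans)
    then show "?P (Inf S)"
      using S lin by (auto simp: trivial_limit_def eventually_Inf_chain intro: Inf_greatest)
  qed (use assms in auto)
  obtain u where u: "ultrafilter u" "u \<le> F"
    using ultrafilter_exists[OF F(1)] by blast
  have "filter_plus F u = F"
  proof (rule min)
    show "filter_plus F u \<noteq> bot"
      using F(1) u(1) by (simp add: filter_plus_neq_bot ultrafilter_def)
    show le: "filter_plus F u \<le> F"
      using filter_plus_mono[OF order_refl u(2)] F(2) by (rule order_trans)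
    have "filter_plus (filter_plus F u) (filter_plus F u)
        = filter_plus F (filter_plus u (filter_plus F u))"
      by (simp add: filter_plus_assoc)
    also have "\<dots> \<le> filter_plus F (filter_plus F (filter_plus F u))"
      by (intro filter_plus_mono order_refl u(2))
    also have "\<dots> = filter_plus (filter_plus (filter_plus F F) F) u"
      by (simp add: filter_plus_assoc)
    also have "\<dots> \<le> filter_plus F u"
      by (intro filter_plus_mono order_refl)
        (meson F(2) filter_plus_mono order_refl order_trans)
    finally show "filter_plus (filter_plus F u) (filter_plus F u) \<le> filter_plus F u" .
  qed
  \<comment> \<open>The largest filter \<open>G \<le> F\<close> with \<open>G + u \<le> u\<close>; it is proper because \<open>F + u = F\<close>.\<close>
  define G where "G = Sup {H. H \<le> F \<and> filter_plus H u \<le> u}"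
  have "G \<le> F"
    unfolding G_def by (rule Sup_least) simp
  have Gu: "filter_plus G u \<le> u"
    unfolding le_filter_def eventually_filter_plus G_def eventually_Sup
    by (auto simp: le_filter_def eventually_filter_plus)
  \<comment> \<open>\<open>H\<close> witnesses that \<open>G\<close> is proper: it adjoins to
    \<open>F\<close> exactly the sets that \<open>filter_plus H u \<le> u\<close> requires.\<close>
  define H where "H = inf F (INF P\<in>{P. eventually P u}. principal {a. eventually (\<lambda>b. P (a + b)) u})"
  have "H \<le> F" by (simp add: H_def)
  have "filter_plus H u \<le> u"
  proof (rule filter_leI)
    fix P
    assume P: "eventually P u"
    have "H \<le> principal {a. eventually (\<lambda>b. P (a + b)) u}"
      unfolding H_def using P by (intro le_infI2 INF_lower) simp
    then show "eventually P (filter_plus H u)"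
      by (simp add: le_principal eventually_filter_plus)
  qed
  have "H \<noteq> bot"
  proof
    assume "H = bot"
    then have "eventually (\<lambda>_. False) H" by simp
    then obtain Q R where Q: "eventually Q F" and
      R: "eventually R (INF P\<in>{P. eventually P u}. principal {a. eventually (\<lambda>b. P (a + b)) u})"
      and QR: "\<And>a. Q a \<Longrightarrow> R a \<Longrightarrow> False"
      unfolding H_def eventually_inf by auto
    \<comment> \<open>Conjoining predicates of \<open>u\<close> refines the generating sets, so a
      single \<open>P\<close> suffices.\<close>
    from R obtain P where P: "eventually P u" and PR: "\<And>a. eventually (\<lambda>b. P (a + b)) u \<Longrightarrow> R a"
    proof (subst (asm) eventually_INF_base, goal_cases)
      case (2 P Q)
      then show ?case
        by (intro bexI[of _ "\<lambda>a. P a \<and> Q a"]) (auto simp: eventually_conj_iff)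
    qed (auto simp: eventually_principal intro: always_eventually)
    \<comment> \<open>On \<open>Q\<close> the condition for \<open>P\<close> fails, and since
      \<open>u\<close> is an ultrafilter it fails in the strong form with the negation inside;
      \<open>filter_plus F u = F\<close> can then absorb the sum.\<close>
    have "eventually (\<lambda>a. eventually (\<lambda>b. \<not> P (a + b)) u) F"
      using Q by eventually_elim (use QR PR ultrafilter_not_eventually[OF u(1)] in blast)
    then have "eventually (\<lambda>a. \<not> P a) F"
      using \<open>filter_plus F u = F\<close> eventually_filter_plus[of "\<lambda>a. \<not> P a" F u] by simp
    then have "eventually (\<lambda>a. \<not> P a) u"
      using u(2) by (rule filter_leD[rotated])
    with P show False
      using ultrafilter_not_eventually[OF u(1)] by blast
  qed
  moreover have "H \<le> G"
    unfolding G_def using \<open>H \<le> F\<close> \<open>filter_plus H u \<le> u\<close> by (intro Sup_upper) simp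
  ultimately have "G \<noteq> bot" by (auto simp: bot_unique)
  have "filter_plus (filter_plus G G) u \<le> filter_plus G u"
    unfolding filter_plus_assoc by (intro filter_plus_mono order_refl Gu)
  then have "filter_plus (filter_plus G G) u \<le> u"
    using Gu by (rule order_trans)
  moreover have "filter_plus G G \<le> F"
    using filter_plus_mono[OF \<open>G \<le> F\<close> \<open>G \<le> F\<close>] F(2) by (rule order_trans)
  ultimately have "filter_plus G G \<le> G"
    by (subst (3) G_def) (auto intro: Sup_upper)
  then have "G = F"
    by (intro min \<open>G \<noteq> bot\<close> \<open>G \<le> F\<close>)
  then have "F = u"
    using Gu \<open>filter_plus F u = F\<close> u(2) by simp
  have "filter_plus u u = u"
    using \<open>filter_plus F u = F\<close> \<open>F = u\<close> by simp
  then show thesis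
    using that u F(3) by fastforce
qed

lemma additively_idempotent_iff: "additively_idempotent u \<longleftrightarrow> filter_plus u u = u"
  by (auto simp: additively_idempotent_def filter_plus_def)

text \<open>Closure of the positive integers under addition makes their principal filter a valid
  starting point.\<close>

lemma idempotent_ultrafilter_in_beta_Npos:
  obtains u where "u \<in> beta_Npos" and "additively_idempotent u"
proof -
  have "filter_plus (principal \<nat>\<^sub>+) (principal \<nat>\<^sub>+) \<le> principal \<nat>\<^sub>+"
    by (auto simp: le_principal eventually_filter_plus eventually_principal Npos_def)
  moreover have "principal \<nat>\<^sub>+ \<noteq> bot"
    by (auto simp: principal_eq_bot_iff Npos_def)
  ultimately obtain u where "ultrafilter u" "u \<le> principal \<nat>\<^sub>+" "filter_plus u u = u"
    using idempotent_ultrafilter_exists by blast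
  then show thesis
    by (intro that[of u]) (auto simp: beta_Npos_def le_principal additively_idempotent_iff)
qed

text \<open>Some residue class \<open>j\<close> modulo \<open>k\<close> belongs to \<open>u\<close>;
  idempotence forces \<open>j + j\<close> into the same class, so \<open>j = 0\<close>.\<close>

lemma eventually_dvd_idempotent:
  fixes u :: "nat filter"
  assumes u: "ultrafilter u" "filter_plus u u = u" and "1 \<le> k"
  shows "eventually (\<lambda>b. k dvd b) u"
proof -
  have "eventually (\<lambda>b. \<exists>j\<in>{..<k}. b mod k = j) u"
    using \<open>1 \<le> k\<close> by (intro always_eventually) auto
  from ultrafilter_finite_union[OF u(1) _ this]
  obtain j where j: "j < k" "eventually (\<lambda>b. b mod k = j) u"
    by auto
  then have "eventually (\<lambda>a. eventually (\<lambda>b. (a + b) mod k = j) u) u"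
    using u(2) eventually_filter_plus[of "\<lambda>b. b mod k = j" u u] by simp
  with j(2) have "eventually (\<lambda>a. a mod k = j \<and> eventually (\<lambda>b. (a + b) mod k = j) u) u"
    by eventually_elim simp
  then obtain a where a: "a mod k = j" "eventually (\<lambda>b. (a + b) mod k = j) u"
    using u(1) eventually_happens' unfolding ultrafilter_def by blast
  from j(2) a(2) have "eventually (\<lambda>b. b mod k = j \<and> (a + b) mod k = j) u"
    by eventually_elim simp
  then obtain b where "b mod k = j" "(a + b) mod k = j"
    using u(1) eventually_happens' unfolding ultrafilter_def by blast
  with a(1) have "(j + j) mod k = j"
    by (metis mod_add_eq)
  with j(1) have "(j + j) mod k = j mod k"
    by simp
  then have "k dvd j"
    by (simp add: mod_eq_dvd_iff_nat)
  with j(1) have "j = 0"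
    by (auto dest: dvd_imp_le)
  with j(2) show ?thesis
    by (simp add: dvd_eq_mod_eq_0)
qed

section \<open>The Galvin construction\<close>

text \<open>
  Galvin's \<open>P\<^sup>\<star>\<close>: unlike a large set \<open>P\<close> itself, it stays large when translated by any
  of its own elements.
\<close>

definition star :: "'a::plus filter \<Rightarrow> ('a \<Rightarrow> bool) \<Rightarrow> 'a \<Rightarrow> bool" where
  "star u P a \<longleftrightarrow> P a \<and> eventually (\<lambda>b. P (a + b)) u"

lemma eventually_star:
  assumes "filter_plus u u = u" and "eventually P u"
  shows "eventually (star u P) u"
  using assms eventually_filter_plus[of P u u]
  by (simp add: star_def[abs_def] eventually_conj_iff)

lemma star_shift:
  fixes u :: "'a::semigroup_add filter"
  assumes "filter_plus u u = u" and "star u P a"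
  shows "eventually (\<lambda>b. star u P (a + b)) u"
proof -
  have "eventually (\<lambda>b. P (a + b)) u"
    using assms(2) by (simp add: star_def)
  then show ?thesis
    using assms(1) eventually_filter_plus[of "\<lambda>b. P (a + b)" u u]
    by (simp add: star_def eventually_conj_iff add.assoc)
qed

text \<open>
  Each stage consists of the set \<open>S\<close> of all sums of earlier terms (including the empty sum) and
  of the large set \<open>Q\<close> from which all sums of later terms will be taken.
\<close>

lemma sum_pairs_from_idempotent:
  fixes u :: "'a::comm_monoid_add filter"
  assumes "u \<noteq> bot" and idem: "filter_plus u u = u"
    and R: "eventually (\<lambda>a. eventually (R a) u) u"
  obtains x :: "nat \<Rightarrow> 'a" where
    "\<And>F G. finite F \<Longrightarrow> finite G \<Longrightarrow> F \<noteq> {} \<Longrightarrow> G \<noteq> {} \<Longrightarrow> Max F < Min G \<Longrightarrow>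
       R (sum x F) (sum x G)"
proof -
  define B where "B = (\<lambda>a. eventually (R a) u)"
  define inv where "inv = (\<lambda>(S, Q). finite S \<and> 0 \<in> S \<and> eventually Q u \<and>
    (\<forall>a. Q a \<longrightarrow> eventually (\<lambda>b. Q (a + b)) u) \<and> (\<forall>s\<in>S. \<forall>b. Q b \<longrightarrow> B (s + b)))"
  \<comment> \<open>\<open>Q (x + b)\<close> lets \<open>x\<close> be put in front of later sums;
    \<open>star\<close> in place of the bare \<open>R (s + x)\<close> keeps the new \<open>Q\<close>
    stable under shifts by its own elements.\<close>
  define step where "step = (\<lambda>(S, Q) (S', Q'). \<exists>x. Q x \<and> S' = S \<union> (\<lambda>s. s + x) ` S \<and>
    Q' = (\<lambda>b. Q b \<and> Q (x + b) \<and> (\<forall>s\<in>S. star u (R (s + x)) b)))"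
  have "\<exists>f. \<forall>n. inv (f n) \<and> step (f n) (f (Suc n))"
  proof (rule dependent_nat_choice)
    \<comment> \<open>Requiring \<open>B\<close> of all sums from the start ensures that each
      \<open>R (s + x)\<close> is large when it is added as a constraint.\<close>
    have "inv ({0}, star u B)"
      using eventually_star[OF idem R] star_shift[OF idem, of B]
      by (simp add: inv_def B_def[symmetric]) (simp add: star_def)
    then show "\<exists>p. inv p" by blast
  next
    fix p :: "'a set \<times> ('a \<Rightarrow> bool)" and n :: nat
    assume p: "inv p"
    obtain S Q where [simp]: "p = (S, Q)" by (cases p)
    have S: "finite S" "0 \<in> S" and Q: "eventually Q u"
      and shift: "\<And>a. Q a \<Longrightarrow> eventually (\<lambda>b. Q (a + b)) u"
      and SB: "\<And>s b. s \<in> S \<Longrightarrow> Q b \<Longrightarrow> B (s + b)"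
      using p by (auto simp: inv_def)
    obtain x where x: "Q x"
      using eventually_happens'[OF assms(1) Q] by blast
    let ?Q' = "\<lambda>b. Q b \<and> Q (x + b) \<and> (\<forall>s\<in>S. star u (R (s + x)) b)"
    have "eventually ?Q' u"
      using Q shift[OF x] SB[OF _ x] S(1)
      by (auto simp: eventually_conj_iff B_def intro!: eventually_ball_finite eventually_star[OF idem])
    \<comment> \<open>Both \<open>a\<close> and \<open>x + a\<close> satisfy \<open>Q\<close>, so
      the old shift property is applied to each.\<close>
    moreover have "eventually (\<lambda>b. ?Q' (a + b)) u" if "?Q' a" for a
      using that shift[of a] shift[of "x + a"] S(1)
      by (auto simp: eventually_conj_iff add.assoc intro!: eventually_ball_finite star_shift[OF idem])
    ultimately have "inv (S \<union> (\<lambda>s. s + x) ` S, ?Q')"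
      using S SB by (auto simp: inv_def add.assoc)
    then show "\<exists>p'. inv p' \<and> step p p'"
      using x by (auto simp: step_def)
  qed
  then obtain f where f: "\<And>n. inv (f n)" "\<And>n. step (f n) (f (Suc n))"
    by blast
  define S where "S n = fst (f n)" for n
  define Q where "Q n = snd (f n)" for n
  have "\<forall>n. \<exists>x. Q n x \<and> S (Suc n) = S n \<union> (\<lambda>s. s + x) ` S n \<and>
      Q (Suc n) = (\<lambda>b. Q n b \<and> Q n (x + b) \<and> (\<forall>s\<in>S n. star u (R (s + x)) b))"
    using f(2) by (simp add: step_def S_def Q_def case_prod_unfold)
  from choice[OF this] obtain x where x_step: "\<forall>n. Q n (x n) \<and>
      S (Suc n) = S n \<union> (\<lambda>s. s + x n) ` S n \<and>
      Q (Suc n) = (\<lambda>b. Q n b \<and> Q n (x n + b) \<and> (\<forall>s\<in>S n. star u (R (s + x n)) b))" ..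
  then have x: "\<And>n. Q n (x n)"
    and S_Suc: "\<And>n. S (Suc n) = S n \<union> (\<lambda>s. s + x n) ` S n"
    and Q_Suc: "\<And>n. Q (Suc n) =
      (\<lambda>b. Q n b \<and> Q n (x n + b) \<and> (\<forall>s\<in>S n. star u (R (s + x n)) b))"
    by simp_all
  have S0: "0 \<in> S n" for n
    using f(1)[of n] by (auto simp: inv_def S_def split: prod.splits)
  have sum_S: "sum x F \<in> S n" if "F \<subseteq> {..<n}" for F n
    using that
  proof (induction n arbitrary: F)
    case 0
    then show ?case using S0 by simp
  next
    case (Suc n)
    have fin: "finite F" using Suc.prems finite_subset by blast
    have "F - {n} \<subseteq> {..<n}" using Suc.prems by (auto simp: less_Suc_eq)
    then have IH: "sum x (F - {n}) \<in> S n" by (rule Suc.IH)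
    show ?case
    proof (cases "n \<in> F")
      case True
      then have "sum x F = sum x (F - {n}) + x n"
        using fin by (simp add: sum.remove add.commute)
      then show ?thesis using IH by (simp add: S_Suc)
    next
      case False
      then show ?thesis using IH by (simp add: S_Suc)
    qed
  qed
  have Q_antimono: "Q m b" if "Q n b" "m \<le> n" for m n b
    using that(2,1) by (induction rule: dec_induct) (auto simp: Q_Suc)
  have sum_Q: "Q n (sum x F)" if "finite F" "F \<noteq> {}" "\<And>i. i \<in> F \<Longrightarrow> n \<le> i" for F n
    using that
  \<comment> \<open>After removal of the least index \<open>k\<close>, a nonempty remainder has its
    sum in \<open>Q (Suc k)\<close>, which was built so that adding \<open>x k\<close> leads back
    into \<open>Q k\<close>.\<close>
  proof (induction F arbitrary: n rule: finite_linorder_min_induct)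
    case empty
    then show ?case by simp
  next
    case (insert k F)
    have "k \<notin> F" using insert.hyps by blast
    have "Q k (sum x (insert k F))"
    proof (cases "F = {}")
      case True
      then show ?thesis using x by simp
    next
      case False
      then have "Q (Suc k) (sum x F)"
        using insert.hyps by (intro insert.IH) auto
      then show ?thesis
        using insert.hyps \<open>k \<notin> F\<close> by (simp add: Q_Suc)
    qed
    then show ?case
      by (rule Q_antimono) (use insert.prems in auto)
  qed
  have "R (sum x F) (sum x G)"
    if "finite F" "finite G" "F \<noteq> {}" "G \<noteq> {}" "Max F < Min G" for F G
  proof -
    \<comment> \<open>Splitting off the last term shows \<open>sum x F\<close> as one of the
      \<open>s + x n\<close> with \<open>n = Max F\<close>, whose constraint is part of
      \<open>Q (Suc n)\<close>.\<close>
    have "F - {Max F} \<subseteq> {..<Max F}"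
      using that(1) by (auto simp: less_le)
    then have "sum x (F - {Max F}) \<in> S (Max F)"
      by (rule sum_S)
    moreover have "sum x F = sum x (F - {Max F}) + x (Max F)"
      using that(1,3) by (simp add: sum.remove[of F "Max F"] add.commute)
    moreover have "Q (Suc (Max F)) (sum x G)"
      using that by (intro sum_Q) (auto simp: Suc_le_eq)
    ultimately show ?thesis
      by (auto simp: Q_Suc star_def)
  qed
  then show thesis by (rule that)
qed

section \<open>Monochromatic quotients\<close>

lemma telescoping_prod_nat:
  fixes z :: "nat \<Rightarrow> nat"
  assumes "\<And>i. 1 \<le> i \<Longrightarrow> z (i - 1) * y i = z i" and "1 \<le> k" and "k \<le> l"
  shows "z (k - 1) * (\<Prod>i=k..l. y i) = z l"
  using assms(3)
proof (induction rule: dec_induct)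
  case base
  then show ?case using assms(1,2) by simp
next
  case (step n)
  then show ?case
    using assms(1)[of "Suc n"] by (simp add: mult.assoc[symmetric])
qed

lemma patterns_in_large_quotient_set:
  assumes u: "u \<in> beta_Npos" "additively_idempotent u"
    and A: "eventually (\<lambda>n. n \<in> A) (filtermap D (u \<otimes>\<^sub>u u))"
  shows "\<exists>x y :: nat \<Rightarrow> nat. (\<forall>i\<in>\<nat>\<^sub>+. x i \<in> \<nat>\<^sub>+) \<and> (\<forall>i\<in>\<nat>\<^sub>+. y i \<in> \<nat>\<^sub>+) \<and>
    of_nat ` FS x \<union> FS_quotients x \<subseteq> of_nat ` A \<and> sums_of_products y \<subseteq> A"
proof -
  have ultra: "ultrafilter u" and pos: "eventually (\<lambda>n. 1 \<le> n) u"
    and idem: "filter_plus u u = u"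
    using u by (auto simp: beta_Npos_def Npos_def additively_idempotent_iff)
  \<comment> \<open>\<open>R\<close> demands genuine divisibility, which excludes the default value
    1 of \<open>D\<close>.\<close>
  define R where "R a b \<longleftrightarrow> 1 \<le> a \<and> 1 \<le> b \<and> a dvd b \<and> b div a \<in> A" for a b :: nat
  have "eventually (\<lambda>a. eventually (\<lambda>b. D (a, b) \<in> A) u) u"
    using A by (simp add: eventually_filtermap eventually_tensor)
  with pos have "eventually (\<lambda>a. eventually (R a) u) u"
  proof eventually_elim
    case (elim a)
    from elim(2) pos eventually_dvd_idempotent[OF ultra idem elim(1)] show ?case
      by eventually_elim (use elim(1) in \<open>simp add: R_def D_def\<close>)
  qed
  then obtain z :: "nat \<Rightarrow> nat" where z: "\<And>F G. finite F \<Longrightarrow> finite G \<Longrightarrow> F \<noteq> {} \<Longrightarrow> G \<noteq> {} \<Longrightarrow>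
      Max F < Min G \<Longrightarrow> R (sum z F) (sum z G)"
    using sum_pairs_from_idempotent[of u R] ultra idem unfolding ultrafilter_def by metis
  have R_single: "R (z k) (sum z G)" if "finite G" "G \<noteq> {}" "k < Min G" for k G
    using z[of "{k}" G] that by simp
  have R_z: "R (z i) (z j)" if "i < j" for i j
    using R_single[of "{j}" i] that by simp
  have z_pos: "0 < z i" for i
    using R_z[of i "Suc i"] by (simp add: R_def)
  \<comment> \<open>Index 0 is reserved for the common divisor \<open>z 0\<close>; only values at
    positive indices matter, and there both divisions are exact.\<close>
  define x where "x i = z i div z 0" for i
  define y where "y i = z i div z (i - 1)" for i
  have zx: "z i = z 0 * x i" if "0 < i" for i
    using R_z[OF that] by (simp add: x_def R_def)
  have zy: "z (i - 1) * y i = z i" if "1 \<le> i" for i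
    using R_z[of "i - 1" i] that by (simp add: y_def R_def)
  have sum_zx: "sum z F = z 0 * sum x F" if "F \<in> Pfin" for F
    using that unfolding sum_distrib_left
    by (intro sum.cong) (auto simp: Pfin_def Npos_def zx subset_iff Suc_le_eq)
  have x_pos: "x i \<in> \<nat>\<^sub>+" if "i \<in> \<nat>\<^sub>+" for i
    using that zx[of i] z_pos[of i] by (auto simp: Npos_def Suc_le_eq intro: gr0I)
  have y_pos: "y i \<in> \<nat>\<^sub>+" if "i \<in> \<nat>\<^sub>+" for i
    using that zy[of i] z_pos[of i] by (auto simp: Npos_def Suc_le_eq intro: gr0I)
  have "FS x \<subseteq> A"
  proof
    fix n assume "n \<in> FS x"
    then obtain F where F: "F \<in> Pfin" "n = sum x F" by (auto simp: FS_def)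
    have "R (z 0) (sum z F)"
      using F(1) by (intro R_single) (auto simp: Pfin_def Npos_def subset_iff Suc_le_eq)
    then show "n \<in> A"
      using sum_zx[OF F(1)] z_pos[of 0] F(2) by (simp add: R_def)
  qed
  moreover have "FS_quotients x \<subseteq> of_nat ` A"
  proof
    fix q assume "q \<in> FS_quotients x"
    then obtain F G where FG: "F \<in> Pfin" "G \<in> Pfin" "Max F < Min G"
      and q: "q = of_nat (sum x G) / of_nat (sum x F)"
      by (auto simp: FS_quotients_def)
    have "R (sum z F) (sum z G)"
      using FG by (intro z) (auto simp: Pfin_def)
    \<comment> \<open>The common factor \<open>z 0\<close> cancels, so the quotients of sums agree
      for \<open>x\<close> and \<open>z\<close>.\<close>
    then have "0 < sum x F" "sum x F dvd sum x G" "sum x G div sum x F \<in> A"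
      using sum_zx FG z_pos[of 0] by (auto simp: R_def intro: gr0I)
    then show "q \<in> of_nat ` A"
      unfolding q
      by (intro image_eqI[of _ _ "sum x G div sum x F"]) (auto elim!: dvdE simp flip: of_nat_sum)
  qed
  moreover have "sums_of_products y \<subseteq> A"
  proof
    fix n assume "n \<in> sums_of_products y"
    then obtain F k where F: "F \<in> Pfin" and k: "1 \<le> k" "k \<le> Min F"
      and n: "n = (\<Sum>l\<in>F. \<Prod>i=k..l. y i)"
      by (auto simp: sums_of_products_def Npos_def)
    have fin: "finite F" "F \<noteq> {}" using F by (auto simp: Pfin_def)
    have "z (k - 1) * n = sum z F"
      unfolding n sum_distrib_left
    proof (rule sum.cong[OF refl])
      fix l assume "l \<in> F"
      then have "k \<le> l" using k(2) fin by auto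
      with k(1) show "z (k - 1) * (\<Prod>i=k..l. y i) = z l"
        by (intro telescoping_prod_nat zy)
    qed
    \<comment> \<open>The left block is \<open>{k - 1}\<close>, which precedes \<open>F\<close>
      because \<open>k \<le> Min F\<close>; for \<open>k = 1\<close> it is the reserved index
      0.\<close>
    moreover have "R (z (k - 1)) (sum z F)"
      using fin k by (intro R_single) auto
    ultimately show "n \<in> A"
      using z_pos[of "k - 1"] by (metis R_def nonzero_mult_div_cancel_left less_numeral_extra(3))
  qed
  ultimately show ?thesis
    using x_pos y_pos by (intro exI[of _ x] exI[of _ y]) auto
qed

text \<open>\<open>D\<close> is positive on positive arguments, so the pushforward is an ultrafilter
  containing the union of the colours, and hence contains one of them.\<close>

lemma colour_of_quotient_ultrafilter:
  assumes "finite_colouring r C" and u: "u \<in> beta_Npos"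
  obtains m where "m \<in> {1..r}" and "eventually (\<lambda>n. n \<in> C m) (filtermap D (u \<otimes>\<^sub>u u))"
proof -
  have ultra: "ultrafilter u" and pos: "eventually (\<lambda>n. 1 \<le> n) u"
    using u by (auto simp: beta_Npos_def Npos_def)
  have D_pos: "1 \<le> D (a, b)" if "1 \<le> a" "1 \<le> b" for a b
    using that by (auto simp: D_def elim!: dvdE)
  have "eventually (\<lambda>a. eventually (\<lambda>b. 1 \<le> D (a, b)) u) u"
    using pos
  proof eventually_elim
    case (elim a)
    from pos show ?case by eventually_elim (rule D_pos[OF elim])
  qed
  then have "eventually (\<lambda>n. n \<in> \<nat>\<^sub>+) (filtermap D (u \<otimes>\<^sub>u u))"
    by (simp add: eventually_filtermap eventually_tensor Npos_def)
  then have "eventually (\<lambda>n. \<exists>m\<in>{1..r}. n \<in> C m) (filtermap D (u \<otimes>\<^sub>u u))"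
    using assms(1) unfolding finite_colouring_def by (simp flip: UN_iff)
  then have "\<exists>m\<in>{1..r}. eventually (\<lambda>n. n \<in> C m) (filtermap D (u \<otimes>\<^sub>u u))"
    by (intro ultrafilter_finite_union ultrafilter_filtermap ultrafilter_tensor ultra) simp
  then show thesis using that by blast
qed

theorem theorem1p4:
  fixes r :: nat and C :: "nat \<Rightarrow> nat set"
  assumes "r \<in> \<nat>\<^sub>+"
    and "finite_colouring r C"
  shows "(\<exists>m\<in>{1..r}. \<exists>x y :: nat \<Rightarrow> nat.
             (\<forall>i\<in>\<nat>\<^sub>+. x i \<in> \<nat>\<^sub>+) \<and> (\<forall>i\<in>\<nat>\<^sub>+. y i \<in> \<nat>\<^sub>+) \<and>
             of_nat ` FS x \<union> FS_quotients x \<subseteq> of_nat ` C m \<and>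
             sums_of_products y \<subseteq> C m) \<and>
         (\<forall>u\<in>beta_Npos. additively_idempotent u \<longrightarrow>
           (\<exists>m\<in>{1..r}. eventually (\<lambda>n. n \<in> C m) (filtermap D (u \<otimes>\<^sub>u u)) \<and>
             (\<exists>x y :: nat \<Rightarrow> nat.
               (\<forall>i\<in>\<nat>\<^sub>+. x i \<in> \<nat>\<^sub>+) \<and> (\<forall>i\<in>\<nat>\<^sub>+. y i \<in> \<nat>\<^sub>+) \<and>
               of_nat ` FS x \<union> FS_quotients x \<subseteq> of_nat ` C m \<and>
               sums_of_products y \<subseteq> C m)))"
proof -
  have patterns: "\<exists>m\<in>{1..r}. eventually (\<lambda>n. n \<in> C m) (filtermap D (u \<otimes>\<^sub>u u)) \<and>
      (\<exists>x y :: nat \<Rightarrow> nat.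
        (\<forall>i\<in>\<nat>\<^sub>+. x i \<in> \<nat>\<^sub>+) \<and> (\<forall>i\<in>\<nat>\<^sub>+. y i \<in> \<nat>\<^sub>+) \<and>
        of_nat ` FS x \<union> FS_quotients x \<subseteq> of_nat ` C m \<and>
        sums_of_products y \<subseteq> C m)"
    if u: "u \<in> beta_Npos" "additively_idempotent u" for u
  proof -
    obtain m where m: "m \<in> {1..r}" "eventually (\<lambda>n. n \<in> C m) (filtermap D (u \<otimes>\<^sub>u u))"
      using colour_of_quotient_ultrafilter[OF assms(2) u(1)] .
    show ?thesis
      by (intro bexI[OF _ m(1)] conjI m(2) patterns_in_large_quotient_set[OF u m(2)])
  qed
  \<comment> \<open>The unconditional claim follows from the one about idempotents as soon as one
    exists.\<close>
  obtain u where "u \<in> beta_Npos" "additively_idempotent u"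
    using idempotent_ultrafilter_in_beta_Npos .
  from patterns[OF this] show ?thesis
    by (intro conjI ballI impI patterns) (elim bexE conjE, rule bexI)
qed

end
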